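(* Let $V$ be an $n$-dimensional vector space over an algebraically closed field of characteristic zero, and let $r,k\ge 1$ be integers with $r+k<n$. Consider the $\mathrm{GL}(V)$-equivariant space of matrices $$\theta_{k,r}\colon \Lambda^kV\to\operatorname{Hom}(\Lambda^rV,\Lambda^{r+k}V),\qquad \theta_{k,r}(\omega)(\eta)=\omega\wedge\eta .$$ If $k\ge 2$, then $\theta_{k,r}$ is not of constant rank.
   Context: A linear map $\theta\colon U\to\operatorname{Hom}(V_1,V_2)$ (a space of matrices) is of constant rank if the linear maps $\theta(u)$, for $u\in U\setminus\{0\}$, all have the same rank. *)

theory Defs
  imports "HOL-Library.Function_Algebras" "HOL-Computational_Algebra.Polynomial"
begin

section \<open>Alternating maps\<close>

text \<open>Elements of \<open>V\<^sup>k\<close> are lists of length \<open>k\<close>; the values of \<open>\<phi>\<close> on lists of other lengths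
  play no role.\<close>

definition alternating_map ::
  "('k::field \<Rightarrow> 'v::ab_group_add \<Rightarrow> 'v) \<Rightarrow> ('k \<Rightarrow> 'w::ab_group_add \<Rightarrow> 'w) \<Rightarrow> nat \<Rightarrow> ('v list \<Rightarrow> 'w) \<Rightarrow> bool"
  where "alternating_map scale scaleW k \<phi> \<longleftrightarrow>
    (\<forall>vs i. length vs = k \<longrightarrow> i < k \<longrightarrow> Vector_Spaces.linear scale scaleW (\<lambda>x. \<phi> (vs[i := x]))) \<and>
    (\<forall>vs. length vs = k \<longrightarrow> \<not> distinct vs \<longrightarrow> \<phi> vs = 0)"

abbreviation alternating_form ::
  "('k::field \<Rightarrow> 'v::ab_group_add \<Rightarrow> 'v) \<Rightarrow> nat \<Rightarrow> ('v list \<Rightarrow> 'k) \<Rightarrow> bool"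
  where "alternating_form scale \<equiv> alternating_map scale (*)"

section \<open>Exterior powers\<close>

text \<open>The type of an exterior power cannot depend on the term \<open>scale\<close>, so exterior powers are
  realised as subspaces of one ambient space: \<open>v\<^sub>1 \<and> \<dots> \<and> v\<^sub>k\<close> is the evaluation functional
  \<open>f \<mapsto> f(v\<^sub>1, \<dots>, v\<^sub>k)\<close> on alternating \<open>k\<close>-linear forms (set to zero on all other functions), and
  \<open>\<Lambda>\<^sup>kV\<close> is the span of these.
  The lemmas \<open>alternating_decomp\<close>, \<open>ext_pow_universal\<close> and \<open>ext_pow_universal_unique\<close> below
  prove the universal property of the exterior power; \<open>wedge_decomp\<close>, \<open>wedge_linear\<close> and \<open>wedge_in_ext_pow\<close> show that \<open>wedge\<close>
  is the exterior product \<open>\<Lambda>\<^sup>kV \<times> \<Lambda>\<^sup>rV \<rightarrow> \<Lambda>\<^sup>k\<^sup>+\<^sup>rV\<close>.\<close>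

definition fscale :: "'k::field \<Rightarrow> ('x \<Rightarrow> 'k) \<Rightarrow> 'x \<Rightarrow> 'k"
  where "fscale c g = (\<lambda>x. c * g x)"

interpretation fun_vs: vector_space "fscale :: 'k::field \<Rightarrow> ('x \<Rightarrow> 'k) \<Rightarrow> 'x \<Rightarrow> 'k"
  by unfold_locales (simp_all add: fscale_def fun_eq_iff algebra_simps)

type_synonym ('v, 'k) multivector = "('v list \<Rightarrow> 'k) \<Rightarrow> 'k"

definition decomp :: "('k::field \<Rightarrow> 'v::ab_group_add \<Rightarrow> 'v) \<Rightarrow> 'v list \<Rightarrow> ('v, 'k) multivector"
  where "decomp scale vs = (\<lambda>f. if alternating_form scale (length vs) f then f vs else 0)"

definition ext_pow :: "('k::field \<Rightarrow> 'v::ab_group_add \<Rightarrow> 'v) \<Rightarrow> nat \<Rightarrow> ('v, 'k) multivector set"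
  where "ext_pow scale k = fun_vs.span {decomp scale vs | vs. length vs = k}"

text \<open>The degrees \<open>k\<close> of \<open>\<omega>\<close> and \<open>r\<close> of \<open>\<eta>\<close> are needed because the product vanishes on functions
  that are not alternating \<open>(k + r)\<close>-linear forms.\<close>

definition wedge :: "('k::field \<Rightarrow> 'v::ab_group_add \<Rightarrow> 'v) \<Rightarrow> nat \<Rightarrow> nat \<Rightarrow>
    ('v, 'k) multivector \<Rightarrow> ('v, 'k) multivector \<Rightarrow> ('v, 'k) multivector"
  where "wedge scale k r \<omega> \<eta> = (\<lambda>f. if alternating_form scale (k + r) f
      then \<omega> (\<lambda>vs. \<eta> (\<lambda>ws. f (vs @ ws))) else 0)"

definition theta :: "('k::field \<Rightarrow> 'v::ab_group_add \<Rightarrow> 'v) \<Rightarrow> nat \<Rightarrow> nat \<Rightarrow>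
    ('v, 'k) multivector \<Rightarrow> ('v, 'k) multivector \<Rightarrow> ('v, 'k) multivector"
  where "theta scale k r \<omega> \<eta> = wedge scale k r \<omega> \<eta>"

section \<open>Spaces of matrices of constant rank\<close>

text \<open>\<open>U\<close> and \<open>V1\<close> are carriers (subspaces of the ambient types) and \<open>scale2\<close> is the scalar
  multiplication of the target: only the values of \<open>\<theta> u\<close> on \<open>V1\<close>, for \<open>u \<in> U\<close>, matter.\<close>

definition rank_on :: "('k::field \<Rightarrow> 'y::ab_group_add \<Rightarrow> 'y) \<Rightarrow> 'x set \<Rightarrow> ('x \<Rightarrow> 'y) \<Rightarrow> nat"
  where "rank_on scale2 V1 T = vector_space.dim scale2 (T ` V1)"

definition constant_rank :: "('k::field \<Rightarrow> 'y::ab_group_add \<Rightarrow> 'y) \<Rightarrow> 'u::zero set \<Rightarrow> 'x set \<Rightarrow>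
    ('u \<Rightarrow> 'x \<Rightarrow> 'y) \<Rightarrow> bool"
  where "constant_rank scale2 U V1 \<theta> \<longleftrightarrow>
    (\<forall>u \<in> U - {0}. \<forall>u' \<in> U - {0}. rank_on scale2 V1 (\<theta> u) = rank_on scale2 V1 (\<theta> u'))"

section \<open>The universal property\<close>

lemma vector_space_self: "vector_space ((*) :: 'k::field \<Rightarrow> 'k \<Rightarrow> 'k)"
  by unfold_locales (simp_all add: algebra_simps)

lemma linear_iff_vs:
  assumes "vector_space s1" "vector_space s2"
  shows "Vector_Spaces.linear s1 s2 f \<longleftrightarrow>
    (\<forall>x y. f (x + y) = f x + f y) \<and> (\<forall>c x. f (s1 c x) = s2 c (f x))"
  using assms by (auto simp: Vector_Spaces.linear_def module_hom_def module_hom_axioms_def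
      vector_space_def module_def)

lemma alternating_comp:
  assumes "alternating_map scale sW k \<phi>" and "Vector_Spaces.linear sW sX l"
  shows "alternating_map scale sX k (\<lambda>vs. l (\<phi> vs))"
proof -
  interpret l: Vector_Spaces.linear sW sX l by fact
  show ?thesis
    using assms Vector_Spaces.linear_compose[OF _ assms(2)]
    unfolding alternating_map_def by (auto simp: o_def)
qed

lemma alternating_decomp:
  fixes scale :: "'k::field \<Rightarrow> 'v::ab_group_add \<Rightarrow> 'v"
  assumes "vector_space scale"
  shows "alternating_map scale fscale k (decomp scale)"
  unfolding alternating_map_def
proof (intro conjI allI impI)
  fix vs :: "'v list" and i assume len: "length vs = k" "i < k"
  have "decomp scale (vs[i := x + y]) f = decomp scale (vs[i := x]) f + decomp scale (vs[i := y]) f"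
    "decomp scale (vs[i := scale c x]) f = c * decomp scale (vs[i := x]) f" for x y c f
    using len by (auto simp: decomp_def alternating_map_def
        linear_iff_vs[OF assms vector_space_self])
  then show "Vector_Spaces.linear scale fscale (\<lambda>x. decomp scale (vs[i := x]))"
    by (simp add: linear_iff_vs[OF assms fun_vs.vector_space_axioms] fun_eq_iff fscale_def)
next
  fix vs :: "'v list" assume "length vs = k" "\<not> distinct vs"
  then show "decomp scale vs = 0"
    by (auto simp: decomp_def alternating_map_def fun_eq_iff)
qed

lemma ext_pow_universal:
  fixes scale :: "'k::field \<Rightarrow> 'v::ab_group_add \<Rightarrow> 'v"
    and scaleW :: "'k \<Rightarrow> 'w::ab_group_add \<Rightarrow> 'w"
  assumes W: "vector_space scaleW" and \<phi>: "alternating_map scale scaleW k \<phi>"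
  shows "\<exists>L. Vector_Spaces.linear fscale scaleW L \<and>
      (\<forall>vs. length vs = k \<longrightarrow> L (decomp scale vs) = \<phi> vs)"
proof -
  interpret W: vector_space scaleW by fact
  interpret K: vector_space "(*) :: 'k \<Rightarrow> 'k \<Rightarrow> 'k" by (rule vector_space_self)
  interpret FW: vector_space_pair "fscale :: 'k \<Rightarrow> ('v, 'k) multivector \<Rightarrow> _" scaleW ..
  interpret WK: vector_space_pair scaleW "(*) :: 'k \<Rightarrow> 'k \<Rightarrow> 'k" ..
  interpret FK: vector_space_pair "fscale :: 'k \<Rightarrow> ('v, 'k) multivector \<Rightarrow> _" "(*) :: 'k \<Rightarrow> 'k \<Rightarrow> 'k" ..
  define D where "D = {decomp scale vs | vs. length vs = k}"
  obtain B where B: "B \<subseteq> D" "fun_vs.independent B" "D \<subseteq> fun_vs.span B"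
    using fun_vs.maximal_independent_subset[of D] by blast
  define g where "g b = \<phi> (SOME vs. length vs = k \<and> decomp scale vs = b)" for b
  define L where "L = FW.construct B g"
  have linL: "Vector_Spaces.linear fscale scaleW L"
    unfolding L_def using FW.linear_construct[OF B(2)] .
  have "L (decomp scale vs) = \<phi> vs" if len: "length vs = k" for vs
  proof (rule ccontr)
    assume ne: "L (decomp scale vs) \<noteq> \<phi> vs"
    define x where "x = L (decomp scale vs) - \<phi> vs"
    have "x \<noteq> 0" using ne by (simp add: x_def)
    then have ind: "W.independent {x}" by simp
    define l where "l = WK.construct {x} (\<lambda>_. 1)"
    have linl: "Vector_Spaces.linear scaleW (*) l"
      unfolding l_def using WK.linear_construct[OF ind] .
    have lx: "l x = 1"
      unfolding l_def using WK.construct_basis[OF ind] by simp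
    have alt: "alternating_form scale k (\<lambda>vs. l (\<phi> vs))"
      by (rule alternating_comp[OF \<phi> linl])
    have dec: "decomp scale ws (\<lambda>vs. l (\<phi> vs)) = l (\<phi> ws)" if "length ws = k" for ws
      using alt that by (simp add: decomp_def)
    define e where "e = (\<lambda>\<omega>::('v, 'k) multivector. \<omega> (\<lambda>vs. l (\<phi> vs)))"
    have lin_lL: "Vector_Spaces.linear fscale (*) (l \<circ> L)"
      by (rule Vector_Spaces.linear_compose[OF linL linl])
    have lin_e: "Vector_Spaces.linear fscale (*) e"
      unfolding linear_iff_vs[OF fun_vs.vector_space_axioms vector_space_self]
      by (simp add: e_def fscale_def)
    have eqB: "(l \<circ> L) b = e b" if b: "b \<in> B" for b
    proof -
      define ws where "ws = (SOME vs. length vs = k \<and> decomp scale vs = b)"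
      have "\<exists>vs. length vs = k \<and> decomp scale vs = b"
        using subsetD[OF B(1) b] unfolding D_def by blast
      then have ws: "length ws = k" "decomp scale ws = b"
        using someI_ex[of "\<lambda>vs. length vs = k \<and> decomp scale vs = b"] by (simp_all add: ws_def)
      have "L b = \<phi> ws"
        unfolding L_def using FW.construct_basis[OF B(2) b] by (simp add: g_def ws_def)
      then show ?thesis
        using dec[OF ws(1)] ws(2) by (simp add: e_def)
    qed
    have "decomp scale vs \<in> D"
      unfolding D_def using len by blast
    then have "decomp scale vs \<in> fun_vs.span B"
      using B(3) by blast
    from FK.linear_eq_on_span[OF lin_lL lin_e eqB this]
    have "(l \<circ> L) (decomp scale vs) = e (decomp scale vs)" .
    then have "l (L (decomp scale vs)) = l (\<phi> vs)"
      using dec[OF len] by (simp add: e_def)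
    moreover have "l x = l (L (decomp scale vs)) - l (\<phi> vs)"
      unfolding x_def using WK.linear_diff[OF linl] .
    ultimately show False using lx by simp
  qed
  then show ?thesis by (intro exI[of _ L] conjI linL allI impI)
qed

lemma ext_pow_universal_unique:
  fixes scale :: "'k::field \<Rightarrow> 'v::ab_group_add \<Rightarrow> 'v"
    and scaleW :: "'k \<Rightarrow> 'w::ab_group_add \<Rightarrow> 'w"
  assumes L: "Vector_Spaces.linear fscale scaleW L" and L': "Vector_Spaces.linear fscale scaleW L'"
    and eq: "\<And>vs. length vs = k \<Longrightarrow> L (decomp scale vs) = L' (decomp scale vs)"
    and \<omega>: "\<omega> \<in> ext_pow scale k"
  shows "L \<omega> = L' \<omega>"
proof -
  interpret L: Vector_Spaces.linear fscale scaleW L by fact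
  interpret FW: vector_space_pair "fscale :: 'k \<Rightarrow> ('v, 'k) multivector \<Rightarrow> _" scaleW ..
  have gen: "L b = L' b" if "b \<in> {decomp scale vs | vs. length vs = k}" for b
    using that eq by blast
  show ?thesis
    by (rule FW.linear_eq_on_span[OF L L' gen \<omega>[unfolded ext_pow_def]])
qed

section \<open>The exterior product\<close>

lemma alternating_append:
  fixes scale :: "'k::field \<Rightarrow> 'v::ab_group_add \<Rightarrow> 'v"
  assumes f: "alternating_form scale (k + r) f"
  shows "length vs = k \<Longrightarrow> alternating_form scale r (\<lambda>ws. f (vs @ ws))"
    and "length ws = r \<Longrightarrow> alternating_form scale k (\<lambda>vs. f (vs @ ws))"
proof -
  have lin: "length us = k + r \<Longrightarrow> i < k + r \<Longrightarrow> Vector_Spaces.linear scale (*) (\<lambda>x. f (us[i := x]))"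
    and zero: "length us = k + r \<Longrightarrow> \<not> distinct us \<Longrightarrow> f us = 0" for us i
    using f by (auto simp: alternating_map_def)
  show "alternating_form scale r (\<lambda>ws. f (vs @ ws))" if "length vs = k"
    unfolding alternating_map_def
  proof (intro conjI allI impI)
    fix ws :: "'v list" and i assume "length ws = r" "i < r"
    then show "Vector_Spaces.linear scale (*) (\<lambda>x. f (vs @ ws[i := x]))"
      using lin[of "vs @ ws" "k + i"] that by (simp add: list_update_append)
  qed (use zero that in auto)
  show "alternating_form scale k (\<lambda>vs. f (vs @ ws))" if "length ws = r"
    unfolding alternating_map_def
  proof (intro conjI allI impI)
    fix vs :: "'v list" and i assume "length vs = k" "i < k"
    then show "Vector_Spaces.linear scale (*) (\<lambda>x. f (vs[i := x] @ ws))"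
      using lin[of "vs @ ws" i] that by (simp add: list_update_append)
  qed (use zero that in auto)
qed

lemma wedge_decomp:
  assumes "length vs = k" "length ws = r"
  shows "wedge scale k r (decomp scale vs) (decomp scale ws) = decomp scale (vs @ ws)"
proof
  fix f
  show "wedge scale k r (decomp scale vs) (decomp scale ws) f = decomp scale (vs @ ws) f"
  proof (cases "alternating_form scale (k + r) f")
    case True
    note alt = alternating_append[OF True]
    have eq: "length us = k \<Longrightarrow> decomp scale ws (\<lambda>ws. f (us @ ws)) = f (us @ ws)" for us
      using alt(1) assms by (simp add: decomp_def)
    have "alternating_form scale k (\<lambda>us. decomp scale ws (\<lambda>ws. f (us @ ws)))"
      using alt(2)[OF assms(2)] by (simp add: alternating_map_def eq)
    then show ?thesis
      using True assms eq[OF assms(1)] by (simp add: wedge_def decomp_def)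
  qed (use assms in \<open>simp add: wedge_def decomp_def\<close>)
qed

lemma alternating_form_add:
  assumes "alternating_form scale k f" "alternating_form scale k g"
  shows "alternating_form scale k (\<lambda>vs. f vs + g vs)"
  using assms unfolding alternating_map_def Vector_Spaces.linear_def module_hom_def module_hom_axioms_def
  by (simp add: algebra_simps)

lemma alternating_form_scale:
  assumes "alternating_form scale k f"
  shows "alternating_form scale k (\<lambda>vs. c * f vs)"
  using assms unfolding alternating_map_def Vector_Spaces.linear_def module_hom_def module_hom_axioms_def
  by (simp add: algebra_simps)

text \<open>Multivectors are arbitrary functionals, hence the linearity of the elements of \<open>\<Lambda>\<^sup>kV\<close> on
  alternating forms has to be proved.\<close>

lemma ext_pow_linear:
  fixes scale :: "'k::field \<Rightarrow> 'v::ab_group_add \<Rightarrow> 'v"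
  assumes \<omega>: "\<omega> \<in> ext_pow scale k"
  shows "\<lbrakk>alternating_form scale k f; alternating_form scale k g\<rbrakk> \<Longrightarrow> \<omega> (\<lambda>vs. f vs + g vs) = \<omega> f + \<omega> g"
    and "alternating_form scale k f \<Longrightarrow> \<omega> (\<lambda>vs. c * f vs) = c * \<omega> f"
    and "(\<And>vs. length vs = k \<Longrightarrow> f vs = g vs) \<Longrightarrow> \<omega> f = \<omega> g"
proof -
  define S1 where "S1 = {\<omega>::('v, 'k) multivector. \<forall>f g. alternating_form scale k f \<longrightarrow>
      alternating_form scale k g \<longrightarrow> \<omega> (\<lambda>vs. f vs + g vs) = \<omega> f + \<omega> g}"
  define S2 where "S2 = {\<omega>::('v, 'k) multivector. \<forall>c f. alternating_form scale k f \<longrightarrow>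
      \<omega> (\<lambda>vs. c * f vs) = c * \<omega> f}"
  define S3 where "S3 = {\<omega>::('v, 'k) multivector. \<forall>f g. (\<forall>vs. length vs = k \<longrightarrow> f vs = g vs) \<longrightarrow>
      \<omega> f = \<omega> g}"
  have sub: "fun_vs.subspace S1" "fun_vs.subspace S2" "fun_vs.subspace S3"
    unfolding fun_vs.subspace_def S1_def S2_def S3_def
    by (simp_all add: fscale_def algebra_simps) metis
  have alt_cong: "alternating_form scale k f = alternating_form scale k g"
    if "\<forall>vs. length vs = k \<longrightarrow> f vs = g vs" for f g :: "'v list \<Rightarrow> 'k"
    using that by (simp add: alternating_map_def)
  have "decomp scale vs \<in> S1 \<and> decomp scale vs \<in> S2" if "length vs = k" for vs
    using that by (simp add: S1_def S2_def decomp_def alternating_form_add alternating_form_scale)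
  moreover have "decomp scale vs \<in> S3" if len: "length vs = k" for vs
    unfolding S3_def
  proof (intro CollectI allI impI)
    fix f g :: "'v list \<Rightarrow> 'k" assume fg: "\<forall>vs. length vs = k \<longrightarrow> f vs = g vs"
    show "decomp scale vs f = decomp scale vs g"
      using alt_cong[OF fg] fg len by (simp add: decomp_def)
  qed
  ultimately have gen: "{decomp scale vs | vs. length vs = k} \<subseteq> S1"
      "{decomp scale vs | vs. length vs = k} \<subseteq> S2"
      "{decomp scale vs | vs. length vs = k} \<subseteq> S3"
    by blast+
  have "\<omega> \<in> S1" "\<omega> \<in> S2" "\<omega> \<in> S3"
    using \<omega> fun_vs.span_minimal[OF gen(1) sub(1)] fun_vs.span_minimal[OF gen(2) sub(2)]
      fun_vs.span_minimal[OF gen(3) sub(3)] by (auto simp: ext_pow_def)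
  then show "\<lbrakk>alternating_form scale k f; alternating_form scale k g\<rbrakk> \<Longrightarrow> \<omega> (\<lambda>vs. f vs + g vs) = \<omega> f + \<omega> g"
    and "alternating_form scale k f \<Longrightarrow> \<omega> (\<lambda>vs. c * f vs) = c * \<omega> f"
    and "(\<And>vs. length vs = k \<Longrightarrow> f vs = g vs) \<Longrightarrow> \<omega> f = \<omega> g"
    by (simp_all add: S1_def S2_def S3_def)
qed

lemma alternating_contract:
  fixes scale :: "'k::field \<Rightarrow> 'v::ab_group_add \<Rightarrow> 'v"
  assumes "vector_space scale" "alternating_form scale (k + r) f" "\<eta> \<in> ext_pow scale r"
  shows "alternating_form scale k (\<lambda>vs. \<eta> (\<lambda>ws. f (vs @ ws)))"
proof -
  note \<eta> = ext_pow_linear[OF assms(3)]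
  note alt = alternating_append[OF assms(2)]
  have lin: "f (vs[i := x + y] @ ws) = f (vs[i := x] @ ws) + f (vs[i := y] @ ws)"
      "f (vs[i := scale c x] @ ws) = c * f (vs[i := x] @ ws)"
    if "length vs = k" "i < k" "length ws = r" for vs ws i x y c
    using alt(2)[OF that(3)] that(1,2)
    by (auto simp: alternating_map_def linear_iff_vs[OF assms(1) vector_space_self])
  have zero: "\<eta> (\<lambda>ws. 0) = 0"
    using \<eta>(2)[of "\<lambda>ws. 0" 0] linear_iff_vs[OF assms(1) vector_space_self]
    by (simp add: alternating_map_def)
  have "\<eta> (\<lambda>ws. f (vs @ ws)) = 0" if "length vs = k" "\<not> distinct vs" for vs
    using \<eta>(3)[of "\<lambda>ws. f (vs @ ws)" "\<lambda>ws. 0"] zero assms(2) that by (simp add: alternating_map_def)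
  moreover have "\<eta> (\<lambda>ws. f (vs[i := x + y] @ ws)) =
        \<eta> (\<lambda>ws. f (vs[i := x] @ ws)) + \<eta> (\<lambda>ws. f (vs[i := y] @ ws))"
      "\<eta> (\<lambda>ws. f (vs[i := scale c x] @ ws)) = c * \<eta> (\<lambda>ws. f (vs[i := x] @ ws))"
    if "length vs = k" "i < k" for vs i x y c
    using \<eta>(1)[OF alt(1) alt(1), of "vs[i := x]" "vs[i := y]"] \<eta>(2)[OF alt(1), of "vs[i := x]" c]
      \<eta>(3)[of "\<lambda>ws. f (vs[i := x + y] @ ws)" "\<lambda>ws. f (vs[i := x] @ ws) + f (vs[i := y] @ ws)"]
      \<eta>(3)[of "\<lambda>ws. f (vs[i := scale c x] @ ws)" "\<lambda>ws. c * f (vs[i := x] @ ws)"]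
      lin that by simp_all
  ultimately show ?thesis
    by (simp add: alternating_map_def linear_iff_vs[OF assms(1) vector_space_self])
qed

lemma wedge_linear:
  shows "wedge scale k r (\<omega> + \<omega>') \<eta> = wedge scale k r \<omega> \<eta> + wedge scale k r \<omega>' \<eta>"
    and "wedge scale k r (fscale c \<omega>) \<eta> = fscale c (wedge scale k r \<omega> \<eta>)"
    and "\<lbrakk>vector_space scale; \<omega> \<in> ext_pow scale k; \<eta> \<in> ext_pow scale r; \<eta>' \<in> ext_pow scale r\<rbrakk> \<Longrightarrow>
      wedge scale k r \<omega> (\<eta> + \<eta>') = wedge scale k r \<omega> \<eta> + wedge scale k r \<omega> \<eta>'"
    and "\<lbrakk>vector_space scale; \<omega> \<in> ext_pow scale k; \<eta> \<in> ext_pow scale r\<rbrakk> \<Longrightarrow>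
      wedge scale k r \<omega> (fscale c \<eta>) = fscale c (wedge scale k r \<omega> \<eta>)"
proof -
  show "wedge scale k r (\<omega> + \<omega>') \<eta> = wedge scale k r \<omega> \<eta> + wedge scale k r \<omega>' \<eta>"
    and "wedge scale k r (fscale c \<omega>) \<eta> = fscale c (wedge scale k r \<omega> \<eta>)"
    by (simp_all add: fun_eq_iff wedge_def fscale_def)
  show "wedge scale k r \<omega> (\<eta> + \<eta>') = wedge scale k r \<omega> \<eta> + wedge scale k r \<omega> \<eta>'"
    if "vector_space scale" "\<omega> \<in> ext_pow scale k" "\<eta> \<in> ext_pow scale r" "\<eta>' \<in> ext_pow scale r"
  proof
    fix f
    show "wedge scale k r \<omega> (\<eta> + \<eta>') f = (wedge scale k r \<omega> \<eta> + wedge scale k r \<omega> \<eta>') f"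
    proof (cases "alternating_form scale (k + r) f")
      case True
      show ?thesis
        using True ext_pow_linear(1)[OF that(2) alternating_contract[OF that(1) True that(3)]
            alternating_contract[OF that(1) True that(4)]] by (simp add: wedge_def)
    qed (simp add: wedge_def)
  qed
  show "wedge scale k r \<omega> (fscale c \<eta>) = fscale c (wedge scale k r \<omega> \<eta>)"
    if "vector_space scale" "\<omega> \<in> ext_pow scale k" "\<eta> \<in> ext_pow scale r"
  proof
    fix f
    show "wedge scale k r \<omega> (fscale c \<eta>) f = fscale c (wedge scale k r \<omega> \<eta>) f"
    proof (cases "alternating_form scale (k + r) f")
      case True
      show ?thesis
        using True ext_pow_linear(2)[OF that(2) alternating_contract[OF that(1) True that(3)]]
        by (simp add: wedge_def fscale_def)
    qed (simp add: wedge_def fscale_def)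
  qed
qed

lemma wedge_in_ext_pow:
  fixes scale :: "'k::field \<Rightarrow> 'v::ab_group_add \<Rightarrow> 'v"
  assumes vs: "vector_space scale" and \<omega>: "\<omega> \<in> ext_pow scale k" and \<eta>: "\<eta> \<in> ext_pow scale r"
  shows "wedge scale k r \<omega> \<eta> \<in> ext_pow scale (k + r)"
proof -
  let ?E = "ext_pow scale (k + r)"
  have E: "fun_vs.subspace ?E"
    unfolding ext_pow_def by (rule fun_vs.subspace_span)
  have dec: "decomp scale us \<in> ext_pow scale m" if "length us = m" for us m
    unfolding ext_pow_def using that by (blast intro: fun_vs.span_base)
  have 0: "wedge scale k r 0 \<eta> = 0" for \<eta>
    by (simp add: fun_eq_iff wedge_def)
  have left: "ext_pow scale k \<subseteq> {\<omega>. wedge scale k r \<omega> (decomp scale ws) \<in> ?E}" if ws: "length ws = r" for ws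
    unfolding ext_pow_def[of scale k]
  proof (rule fun_vs.span_minimal)
    show "fun_vs.subspace {\<omega>. wedge scale k r \<omega> (decomp scale ws) \<in> ?E}"
      using E unfolding fun_vs.subspace_def by (simp add: wedge_linear(1,2) 0)
    show "{decomp scale vs | vs. length vs = k} \<subseteq> {\<omega>. wedge scale k r \<omega> (decomp scale ws) \<in> ?E}"
    proof
      fix \<omega> assume "\<omega> \<in> {decomp scale vs | vs. length vs = k}"
      then obtain vs where "\<omega> = decomp scale vs" "length vs = k" by blast
      then show "\<omega> \<in> {\<omega>. wedge scale k r \<omega> (decomp scale ws) \<in> ?E}"
        using dec[of "vs @ ws" "k + r"] ws by (simp add: wedge_decomp)
    qed
  qed
  have wr0: "wedge scale k r \<omega> 0 = 0"
    using wedge_linear(4)[OF vs \<omega> \<eta>, of 0] by simp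
  have "ext_pow scale r \<subseteq> {\<eta> \<in> ext_pow scale r. wedge scale k r \<omega> \<eta> \<in> ?E}"
    unfolding ext_pow_def[of scale r]
  proof (rule fun_vs.span_minimal, unfold ext_pow_def[of scale r, symmetric])
    have "fun_vs.subspace (ext_pow scale r)"
      unfolding ext_pow_def by (rule fun_vs.subspace_span)
    then show "fun_vs.subspace {\<eta> \<in> ext_pow scale r. wedge scale k r \<omega> \<eta> \<in> ?E}"
      using E wr0 unfolding fun_vs.subspace_def by (simp add: wedge_linear(3,4)[OF vs \<omega>])
    show "{decomp scale vs | vs. length vs = r} \<subseteq> {\<eta> \<in> ext_pow scale r. wedge scale k r \<omega> \<eta> \<in> ?E}"
    proof
      fix \<eta> assume "\<eta> \<in> {decomp scale vs | vs. length vs = r}"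
      then obtain ws where "\<eta> = decomp scale ws" "length ws = r" by blast
      then show "\<eta> \<in> {\<eta> \<in> ext_pow scale r. wedge scale k r \<omega> \<eta> \<in> ?E}"
        using dec[of ws r] left[of ws] \<omega> by blast
    qed
  qed
  with \<eta> show ?thesis by blast
qed

end

theory Submission
  imports Defs "Jordan_Normal_Form.Determinant"
begin

text \<open>
  Let \<open>a\<close> be the wedge of the first \<open>k - 2\<close> vectors of a basis of \<open>V\<close>, let \<open>x, y, u, w\<close> be the next
  four (there are at least four more because \<open>n \<ge> k + 2\<close>), and put
  \<open>\<omega>\<^sub>0 = a \<and> x \<and> y\<close> and \<open>\<omega>\<^sub>1 = a \<and> x \<and> y + a \<and> u \<and> w\<close>. Both are nonzero, and
  \<open>\<theta>(\<omega>\<^sub>1)\<close> has larger rank than \<open>\<theta>(\<omega>\<^sub>0)\<close>.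

  To compare the two images, let \<open>Q\<close> be the projection of \<open>\<Lambda>\<^sup>k\<^sup>+\<^sup>rV\<close> that keeps the basis multivectors
  containing \<open>y\<close> and kills the others. If \<open>P\<close> kills \<open>y\<close> and fixes the other basis vectors, then
  \<open>Q = id - \<Lambda>P\<close>. Two facts about \<open>Q\<close> give the strict inequality
  (lemma \<open>rank_wedge_decomp_less\<close>).

  \<^item> \<open>Q\<close> maps the image of \<open>\<theta>(\<omega>\<^sub>1)\<close> onto a space containing the image of \<open>\<theta>(\<omega>\<^sub>0)\<close>. Indeed, for a wedge
    \<open>\<beta>\<close> of \<open>r\<close> basis vectors, if \<open>y\<close> does not occur in \<open>\<beta>\<close> then
    \<open>Q(\<omega>\<^sub>1 \<and> \<beta>) = a \<and> x \<and> y \<and> \<beta> = \<omega>\<^sub>0 \<and> \<beta>\<close>, and if \<open>y\<close> occurs then \<open>\<omega>\<^sub>0 \<and> \<beta> = 0\<close>.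
  \<^item> \<open>Q\<close> is not injective on the image of \<open>\<theta>(\<omega>\<^sub>1)\<close>. Let \<open>s\<close> be the wedge of \<open>r - 1\<close> further basis
    vectors; they exist because \<open>r + k < n\<close>. Then \<open>\<omega>\<^sub>1 \<and> x \<and> s = a \<and> u \<and> w \<and> x \<and> s\<close> is nonzero,
    but \<open>y\<close> does not occur in it.

  For a multivector of distinct basis vectors to be nonzero there must be an alternating form that
  does not vanish on these vectors; the determinant of coordinates is one
  (lemma \<open>decomp_basis_nonzero\<close>).
\<close>

section \<open>Multivectors of basis vectors\<close>

context vector_space
begin

lemma decomp_not_distinct:
  assumes "\<not> distinct vs"
  shows "decomp scale vs = 0"
  using alternating_decomp[OF vector_space_axioms, of "length vs"] assms
  by (auto simp: alternating_map_def)

lemma decomp_linear_in_slot: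
  assumes "i < length vs"
  shows "Vector_Spaces.linear scale fscale (\<lambda>x. decomp scale (vs[i := x]))"
  using alternating_decomp[OF vector_space_axioms, of "length vs"] assms
  by (auto simp: alternating_map_def)

text \<open>Laplace expansion along a row exhibits linearity in the vector of that row, since the cofactors do
  not involve it.\<close>

lemma coordinate_determinant_alternating:
  assumes "independent B" "span B = UNIV"
  shows "alternating_form scale q
    (\<lambda>vs. det (mat q q (\<lambda>(i, j). representation B (vs ! i) (es ! j))))"
proof -
  let ?M = "\<lambda>vs. mat q q (\<lambda>(i, j). representation B (vs ! i) (es ! j))"
  have expand: "det (?M (vs[i := x])) =
      (\<Sum>j<q. representation B x (es ! j) * cofactor (?M vs) i j)"
    if "length vs = q" "i < q" for vs i x
  proof -
    have "mat_delete (?M (vs[i := x])) i j = mat_delete (?M vs) i j" if "j < q" for j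
      using \<open>length vs = q\<close> \<open>i < q\<close> that
      by (intro eq_matI) (auto simp: mat_delete_def nth_list_update)
    then show ?thesis
      using that laplace_expansion_row[of "?M (vs[i := x])" q i]
      by (auto simp: cofactor_def intro!: sum.cong)
  qed
  have "Vector_Spaces.linear scale (*) (\<lambda>x. det (?M (vs[i := x])))"
    if "length vs = q" "i < q" for vs i
    unfolding linear_iff_vs[OF vector_space_axioms vector_space_self] expand[OF that]
    using assms
    by (simp add: representation_add representation_scale algebra_simps sum.distrib sum_distrib_left)
  moreover have "det (?M vs) = 0" if len: "length vs = q" and nd: "\<not> distinct vs" for vs
  proof -
    obtain i j where ij: "i < q" "j < q" "i \<noteq> j" "vs ! i = vs ! j"
      using nd len by (auto simp: distinct_conv_nth)
    show ?thesis
      by (rule det_identical_rows[of _ q i j]) (use ij in auto)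
  qed
  ultimately show ?thesis
    by (simp add: alternating_map_def)
qed

text \<open>The form that detects \<open>es\<close> is the determinant of the coordinates at \<open>es\<close>: on \<open>es\<close> itself the
  matrix of coordinates is the identity.\<close>

lemma decomp_basis_nonzero:
  assumes "independent B" "span B = UNIV" "distinct es" "set es \<subseteq> B"
  shows "decomp scale es \<noteq> 0"
proof
  assume zero: "decomp scale es = 0"
  let ?q = "length es"
  let ?f = "\<lambda>vs. det (mat ?q ?q (\<lambda>(i, j). representation B (vs ! i) (es ! j)))"
  have "mat ?q ?q (\<lambda>(i, j). representation B (es ! i) (es ! j)) = 1\<^sub>m ?q"
    using assms
    by (intro eq_matI) (auto simp: representation_basis subset_iff nth_eq_iff_index_eq)
  then have "?f es = 1"
    by simp
  then have "decomp scale es ?f = 1"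
    using coordinate_determinant_alternating[OF assms(1,2)] by (simp add: decomp_def)
  then show False
    by (simp add: zero)
qed

text \<open>Multilinear expansion, one slot at a time from the right: \<open>us\<close> is the part of the list whose
  entries have already been replaced by basis vectors, and \<open>ps\<close> is still arbitrary.\<close>

lemma decomp_in_span_basis:
  assumes "span B = UNIV"
  shows "set us \<subseteq> B \<Longrightarrow> decomp scale (ps @ us) \<in>
    fun_vs.span {decomp scale bs | bs. length bs = length ps + length us \<and> set bs \<subseteq> B}"
proof (induction ps arbitrary: us rule: rev_induct)
  case Nil
  then show ?case
    by (auto intro!: fun_vs.span_base)
next
  case (snoc v ps)
  let ?S = "fun_vs.span {decomp scale bs | bs. length bs = length (ps @ [v]) + length us \<and> set bs \<subseteq> B}"
  let ?g = "\<lambda>x. decomp scale (ps @ x # us)"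
  have lin: "Vector_Spaces.linear scale fscale ?g"
    using decomp_linear_in_slot[of "length ps" "ps @ v # us"] by (simp add: list_update_append)
  interpret g: Vector_Spaces.linear scale fscale ?g by fact
  have "v \<in> span B"
    using assms by simp
  then have "?g v \<in> ?S"
  proof (induction rule: span_induct_alt)
    case base
    show ?case
      unfolding g.zero by (rule fun_vs.span_zero)
  next
    case (step c b x)
    have "?g b \<in> ?S"
      using snoc.IH[of "b # us"] snoc.prems step by simp
    then show ?case
      unfolding g.add g.scale using step by (intro fun_vs.span_add fun_vs.span_scale) simp_all
  qed
  then show ?case
    by simp
qed

lemma ext_pow_eq_span_basis:
  assumes "span B = UNIV"
  shows "ext_pow scale q = fun_vs.span {decomp scale bs | bs. length bs = q \<and> set bs \<subseteq> B}"
proof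
  show "ext_pow scale q \<subseteq> fun_vs.span {decomp scale bs | bs. length bs = q \<and> set bs \<subseteq> B}"
    unfolding ext_pow_def
    using decomp_in_span_basis[OF assms, of "[]"]
    by (intro fun_vs.span_minimal fun_vs.subspace_span) auto
  show "fun_vs.span {decomp scale bs | bs. length bs = q \<and> set bs \<subseteq> B} \<subseteq> ext_pow scale q"
    unfolding ext_pow_def by (intro fun_vs.span_mono) auto
qed

lemma decomp_in_ext_pow:
  assumes "length vs = q"
  shows "decomp scale vs \<in> ext_pow scale q"
  unfolding ext_pow_def using assms by (blast intro: fun_vs.span_base)

text \<open>Multivectors are arbitrary functionals, and \<open>\<eta> \<mapsto> \<omega> \<and> \<eta>\<close> is linear only as long as \<open>\<eta>\<close> stays in
  \<open>\<Lambda>\<^sup>rV\<close>. The induction over the span therefore carries membership in \<open>\<Lambda>\<^sup>rV\<close> along.\<close>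

lemma wedge_image_in_span:
  assumes B: "span B = UNIV" and \<omega>: "\<omega> \<in> ext_pow scale k"
    and basis: "\<And>bs. length bs = r \<Longrightarrow> set bs \<subseteq> B \<Longrightarrow> wedge scale k r \<omega> (decomp scale bs) \<in> fun_vs.span X"
  shows "wedge scale k r \<omega> ` ext_pow scale r \<subseteq> fun_vs.span X"
proof -
  let ?D = "{decomp scale bs | bs. length bs = r \<and> set bs \<subseteq> B}"
  have span_D: "fun_vs.span ?D = ext_pow scale r"
    using ext_pow_eq_span_basis[OF B] by simp
  have "\<eta> \<in> ext_pow scale r \<and> wedge scale k r \<omega> \<eta> \<in> fun_vs.span X" if "\<eta> \<in> fun_vs.span ?D" for \<eta>
    using that
  proof (induction rule: fun_vs.span_induct_alt)
    case base
    have "wedge scale k r \<omega> 0 = 0"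
      using wedge_linear(4)[OF vector_space_axioms \<omega> decomp_in_ext_pow[of "replicate r 0" r], of 0]
      by simp
    then show ?case
      by (simp only: fun_vs.span_zero flip: span_D)
  next
    case (step c \<beta> \<eta>)
    have \<beta>: "\<beta> \<in> ext_pow scale r" "wedge scale k r \<omega> \<beta> \<in> fun_vs.span X"
      using step.hyps basis fun_vs.span_base[OF step.hyps] by (auto simp: span_D)
    have c\<beta>: "fscale c \<beta> \<in> ext_pow scale r"
      using \<beta>(1) fun_vs.span_scale[of \<beta> ?D c] by (simp only: span_D)
    have \<eta>: "\<eta> \<in> ext_pow scale r" "wedge scale k r \<omega> \<eta> \<in> fun_vs.span X"
      using step.IH by blast+
    have "fscale c \<beta> + \<eta> \<in> ext_pow scale r"
      using c\<beta> \<eta>(1) fun_vs.span_add[of "fscale c \<beta>" ?D \<eta>] by (simp only: span_D)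
    moreover have "wedge scale k r \<omega> (fscale c \<beta> + \<eta>) \<in> fun_vs.span X"
      unfolding wedge_linear(3)[OF vector_space_axioms \<omega> c\<beta> \<eta>(1)]
        wedge_linear(4)[OF vector_space_axioms \<omega> \<beta>(1)]
      by (intro fun_vs.span_add fun_vs.span_scale \<beta>(2) \<eta>(2))
    ultimately show ?case ..
  qed
  then show ?thesis
    using span_D by blast
qed

end

section \<open>Splitting off the part divisible by a basis vector\<close>

text \<open>This is \<open>id - \<Lambda>P\<close>, written through the pullback of alternating forms along \<open>P\<close>. The name refers to
  the case in which \<open>P\<close> kills one basis vector \<open>y\<close> and fixes the others: what remains of a
  multivector is then the part divisible by \<open>y\<close>. The case distinction is there because the pullback
  of a form that is not alternating can be alternating.\<close>

definition divisible_part ::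
  "('k::field \<Rightarrow> 'v::ab_group_add \<Rightarrow> 'v) \<Rightarrow> nat \<Rightarrow> ('v \<Rightarrow> 'v) \<Rightarrow> ('v, 'k) multivector \<Rightarrow> ('v, 'k) multivector"
  where "divisible_part scale q P \<mu> =
    (\<lambda>f. if alternating_form scale q f then \<mu> f - \<mu> (\<lambda>vs. f (map P vs)) else 0)"

lemma divisible_part_linear: "Vector_Spaces.linear fscale fscale (divisible_part scale q P)"
  unfolding linear_iff_vs[OF fun_vs.vector_space_axioms fun_vs.vector_space_axioms]
  by (auto simp: divisible_part_def fscale_def fun_eq_iff algebra_simps)

lemma alternating_form_map:
  assumes P: "Vector_Spaces.linear scale scale P" and f: "alternating_form scale q f"
  shows "alternating_form scale q (\<lambda>vs. f (map P vs))"
proof -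
  have "Vector_Spaces.linear scale (*) (\<lambda>x. f (map P (vs[i := x])))"
    if "length vs = q" "i < q" for vs i
  proof -
    have "Vector_Spaces.linear scale (*) (\<lambda>x. f ((map P vs)[i := x]))"
      using f that by (simp add: alternating_map_def)
    from Vector_Spaces.linear_compose[OF P this] show ?thesis
      by (simp add: o_def map_update)
  qed
  then show ?thesis
    using f by (auto simp: alternating_map_def distinct_map)
qed

lemma divisible_part_decomp:
  assumes "Vector_Spaces.linear scale scale P" "length vs = q"
  shows "divisible_part scale q P (decomp scale vs) = decomp scale vs - decomp scale (map P vs)"
  using assms by (auto simp: divisible_part_def decomp_def fun_eq_iff alternating_form_map)

context vector_space
begin

lemma basis_vector_annihilator:
  assumes "independent B" "span B = UNIV" "y \<in> B"
  obtains P where "Vector_Spaces.linear scale scale P" "P y = 0" "\<And>b. b \<in> B - {y} \<Longrightarrow> P b = b"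
proof
  let ?P = "\<lambda>v. v - scale (representation B v y) y"
  show "Vector_Spaces.linear scale scale ?P"
    unfolding linear_iff_vs[OF vector_space_axioms vector_space_axioms]
    using assms
    by (simp add: representation_add representation_scale scale_left_distrib scale_right_diff_distrib)
  show "?P y = 0" "\<And>b. b \<in> B - {y} \<Longrightarrow> ?P b = b"
    using assms by (auto simp: representation_basis)
qed

lemma divisible_part_of_divisible:
  assumes P: "Vector_Spaces.linear scale scale P" "P y = 0" and "y \<in> set vs" "length vs = q"
  shows "divisible_part scale q P (decomp scale vs) = decomp scale vs"
proof -
  obtain i where i: "i < length vs" "vs ! i = y"
    using assms by (auto simp: in_set_conv_nth)
  interpret g: Vector_Spaces.linear scale fscale "\<lambda>x. decomp scale ((map P vs)[i := x])"
    by (rule decomp_linear_in_slot) (simp add: i)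
  have "(map P vs)[i := 0] = map P vs"
    using i P by (metis list_update_id length_map nth_map)
  then have "decomp scale (map P vs) = 0"
    using g.zero by simp
  then show ?thesis
    using divisible_part_decomp[OF P(1) assms(4)] by simp
qed

lemma divisible_part_of_fixed:
  assumes "Vector_Spaces.linear scale scale P" "\<And>v. v \<in> set vs \<Longrightarrow> P v = v" "length vs = q"
  shows "divisible_part scale q P (decomp scale vs) = 0"
  using divisible_part_decomp[OF assms(1,3)] assms(2) by (simp add: map_idI)

end

section \<open>Comparing ranks\<close>

text \<open>Extend \<open>z\<close> to a basis of the span of \<open>M\<close> inside \<open>M\<close>. As \<open>Q\<close> kills \<open>z\<close>, the images of the other
  basis vectors already span \<open>Q ` M\<close>, hence \<open>N\<close>. Finiteness of \<open>F\<close> matters because \<open>dim\<close> is \<open>0\<close> on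
  infinite-dimensional spaces.\<close>

lemma dim_less_of_projection:
  fixes Q :: "('x \<Rightarrow> 'k::field) \<Rightarrow> ('x \<Rightarrow> 'k)"
  assumes Q: "Vector_Spaces.linear fscale fscale Q"
    and fin: "finite F" "M \<subseteq> fun_vs.span F"
    and N: "N \<subseteq> fun_vs.span (Q ` M)"
    and z: "z \<in> M" "z \<noteq> 0" "Q z = 0"
  shows "fun_vs.dim N < fun_vs.dim M"
proof -
  interpret Q: Vector_Spaces.linear fscale fscale Q by fact
  have "{z} \<subseteq> M" "fun_vs.independent {z}"
    using z by simp_all
  then obtain B where B: "{z} \<subseteq> B" "B \<subseteq> M" "fun_vs.independent B" "M \<subseteq> fun_vs.span B"
    by (rule fun_vs.maximal_independent_subset_extend)
  have finB: "finite B"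
    using fun_vs.independent_span_bound[OF fin(1) B(3)] B(2) fin(2) by blast
  have "Q ` M \<subseteq> fun_vs.span (Q ` B)"
    using B(4) Q.span_image[of B] by auto
  moreover have "Q ` B \<subseteq> fun_vs.span (Q ` (B - {z}))"
  proof (intro image_subsetI)
    fix b assume "b \<in> B"
    show "Q b \<in> fun_vs.span (Q ` (B - {z}))"
    proof (cases "b = z")
      case True
      then show ?thesis
        by (simp only: z(3) fun_vs.span_zero)
    next
      case False
      then show ?thesis
        using \<open>b \<in> B\<close> by (intro fun_vs.span_base) blast
    qed
  qed
  ultimately have "N \<subseteq> fun_vs.span (Q ` (B - {z}))"
    using N by (meson fun_vs.span_minimal fun_vs.subspace_span order_trans)
  then have "fun_vs.dim N \<le> card (Q ` (B - {z}))"
    using finB by (intro fun_vs.dim_le_card) auto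
  also have "\<dots> \<le> card (B - {z})"
    using finB by (intro card_image_le) simp
  also have "\<dots> < card B"
    using B(1) finB by (intro psubset_card_mono) auto
  also have "card B = fun_vs.dim M"
    by (rule fun_vs.basis_card_eq_dim[OF B(2,4,3)])
  finally show ?thesis .
qed

text \<open>The projection \<open>Q\<close> to the part divisible by \<open>y\<close> sends the image of \<open>\<eta> \<mapsto> \<omega>1 \<and> \<eta>\<close> onto a space
  containing the image of \<open>\<eta> \<mapsto> \<omega>0 \<and> \<eta>\<close>, and it kills a nonzero element \<open>z\<close> of the former.\<close>

lemma (in vector_space) rank_wedge_decomp_less:
  fixes a ss :: "'b list" and x y u w :: 'b
  assumes B: "independent B" "span B = UNIV" "finite B"
    and es: "distinct (a @ [x, y, u, w] @ ss)" "set (a @ [x, y, u, w] @ ss) \<subseteq> B"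
    and k: "k = length a + 2" and r: "r = length ss + 1"
  defines "\<omega>0 \<equiv> decomp scale (a @ [x, y])"
    and "\<omega>1 \<equiv> decomp scale (a @ [x, y]) + decomp scale (a @ [u, w])"
  shows "rank_on fscale (ext_pow scale r) (wedge scale k r \<omega>0)
    < rank_on fscale (ext_pow scale r) (wedge scale k r \<omega>1)"
    and "\<omega>0 \<noteq> 0" and "\<omega>1 \<noteq> 0"
proof -
  have \<omega>0: "\<omega>0 \<in> ext_pow scale k"
    unfolding \<omega>0_def k by (rule decomp_in_ext_pow) simp
  have \<omega>1: "\<omega>1 \<in> ext_pow scale k"
    using decomp_in_ext_pow[of "a @ [x, y]" k] decomp_in_ext_pow[of "a @ [u, w]" k]
    unfolding \<omega>1_def k ext_pow_def by (simp add: fun_vs.span_add)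
  have wedge0: "wedge scale k r \<omega>0 (decomp scale bs) = decomp scale (a @ [x, y] @ bs)"
    and wedge1: "wedge scale k r \<omega>1 (decomp scale bs) =
      decomp scale (a @ [x, y] @ bs) + decomp scale (a @ [u, w] @ bs)" if "length bs = r" for bs
    using that by (simp_all add: \<omega>0_def \<omega>1_def wedge_linear wedge_decomp k)

  \<comment> \<open>The factor \<open>x\<close> kills the summand \<open>a \<and> x \<and> y\<close> of \<open>\<omega>1\<close>, the only one in which \<open>y\<close> occurs.\<close>
  define z where "z = wedge scale k r \<omega>1 (decomp scale (x # ss))"
  have z_eq: "z = decomp scale (a @ [u, w] @ x # ss)"
    unfolding z_def using wedge1[of "x # ss"] by (simp add: r decomp_not_distinct)
  have "z \<noteq> 0"
    unfolding z_eq using es by (intro decomp_basis_nonzero[OF B(1,2)]) auto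
  show "\<omega>0 \<noteq> 0"
    unfolding \<omega>0_def using es by (intro decomp_basis_nonzero[OF B(1,2)]) auto
  show "\<omega>1 \<noteq> 0"
  proof
    assume "\<omega>1 = 0"
    have "wedge scale k r 0 (decomp scale (x # ss)) = 0"
      by (rule ext) (simp add: wedge_def)
    then have "z = 0"
      unfolding z_def \<open>\<omega>1 = 0\<close> .
    with \<open>z \<noteq> 0\<close> show False ..
  qed

  obtain P where P: "Vector_Spaces.linear scale scale P" "P y = 0" "\<And>b. b \<in> B - {y} \<Longrightarrow> P b = b"
    using es by (auto intro: basis_vector_annihilator[OF B(1,2), of y])
  define Q where "Q = divisible_part scale (k + r) P"
  interpret Q: Vector_Spaces.linear fscale fscale Q
    unfolding Q_def by (rule divisible_part_linear)
  have "Q z = 0"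
    unfolding Q_def z_eq using es by (intro divisible_part_of_fixed P) (auto simp: k r)

  let ?M = "wedge scale k r \<omega>1 ` ext_pow scale r"
  have "wedge scale k r \<omega>0 (decomp scale bs) \<in> fun_vs.span (Q ` ?M)"
    if bs: "length bs = r" "set bs \<subseteq> B" for bs
  proof (cases "y \<in> set bs")
    case True
    then show ?thesis
      using bs by (simp add: wedge0 decomp_not_distinct fun_vs.span_zero)
  next
    case False
    have "Q (decomp scale (a @ [x, y] @ bs)) = decomp scale (a @ [x, y] @ bs)"
      unfolding Q_def using bs by (intro divisible_part_of_divisible[OF P(1,2)]) (auto simp: k)
    moreover have "Q (decomp scale (a @ [u, w] @ bs)) = 0"
      unfolding Q_def using es bs False by (intro divisible_part_of_fixed P) (auto simp: k)
    ultimately have "wedge scale k r \<omega>0 (decomp scale bs) = Q (wedge scale k r \<omega>1 (decomp scale bs))"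
      using bs by (simp add: wedge0 wedge1 Q.add)
    then show ?thesis
      using bs by (auto intro!: fun_vs.span_base imageI decomp_in_ext_pow)
  qed
  then have N: "wedge scale k r \<omega>0 ` ext_pow scale r \<subseteq> fun_vs.span (Q ` ?M)"
    by (rule wedge_image_in_span[OF B(2) \<omega>0])

  let ?F = "{decomp scale bs | bs. length bs = k + r \<and> set bs \<subseteq> B}"
  have "finite ((decomp scale) ` {bs. set bs \<subseteq> B \<and> length bs = k + r})"
    using finite_lists_length_eq[OF B(3)] by blast
  then have F: "finite ?F"
    by (rule rev_finite_subset) auto
  have M: "?M \<subseteq> fun_vs.span ?F"
    using wedge_in_ext_pow[OF vector_space_axioms \<omega>1] ext_pow_eq_span_basis[OF B(2)] by blast
  have "z \<in> ?M"
    unfolding z_def by (intro imageI decomp_in_ext_pow) (simp add: r)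
  have "fun_vs.dim (wedge scale k r \<omega>0 ` ext_pow scale r) < fun_vs.dim ?M"
  proof (rule dim_less_of_projection[where Q = Q and F = ?F and z = z])
    show "Vector_Spaces.linear fscale fscale Q"
      unfolding Q_def by (rule divisible_part_linear)
  qed fact+
  then show "rank_on fscale (ext_pow scale r) (wedge scale k r \<omega>0)
      < rank_on fscale (ext_pow scale r) (wedge scale k r \<omega>1)"
    by (simp only: rank_on_def)
qed

section \<open>Failure of constant rank\<close>

theorem proposition4p1:
  fixes scale :: "'k::{alg_closed_field, field_char_0} \<Rightarrow> 'v::ab_group_add \<Rightarrow> 'v"
    and Basis :: "'v set" and n r k :: nat
  assumes "finite_dimensional_vector_space scale Basis"
    and "vector_space.dim scale (UNIV :: 'v set) = n"
    and "r \<ge> 1" and "k \<ge> 1" and "r + k < n"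
    and "k \<ge> 2"
  shows "\<not> constant_rank fscale (ext_pow scale k) (ext_pow scale r) (theta scale k r)"
proof
  assume const: "constant_rank fscale (ext_pow scale k) (ext_pow scale r) (theta scale k r)"
  interpret finite_dimensional_vector_space scale Basis by fact
  obtain es where es: "set es = Basis" "distinct es"
    using finite_distinct_list[OF finite_Basis] by blast
  have "card Basis = n"
    using assms(2) independent_Basis span_Basis by (metis dim_UNIV dimension_def)
  then have len: "length es = n"
    using es distinct_card by fastforce
  define a where "a = take (k - 2) es"
  have "length (drop (k - 2) es) = Suc (Suc (Suc (Suc (n - k - 2))))"
    using assms len by simp
  then obtain x y u w rest where rest: "drop (k - 2) es = x # y # u # w # rest"
    unfolding length_Suc_conv by blast
  define ss where "ss = take (r - 1) rest"
  have split: "es = (a @ [x, y, u, w] @ ss) @ drop (r - 1) rest"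
    using append_take_drop_id[of "k - 2" es] by (simp add: rest a_def ss_def)
  have "length rest = n - k - 2"
    using arg_cong[OF rest, of length] assms len by simp
  have split_distinct: "distinct (a @ [x, y, u, w] @ ss)"
    using es(2) unfolding split[THEN arg_cong[where f = distinct]] distinct_append[of "a @ _"] by blast
  have split_basis: "set (a @ [x, y, u, w] @ ss) \<subseteq> Basis"
    using es(1) unfolding split[THEN arg_cong[where f = set]] set_append[of "a @ _"] by blast
  have k: "k = length a + 2" and r: "r = length ss + 1"
    using assms len \<open>length rest = n - k - 2\<close> by (simp_all add: a_def ss_def)
  let ?\<omega>0 = "decomp scale (a @ [x, y])"
  let ?\<omega>1 = "decomp scale (a @ [x, y]) + decomp scale (a @ [u, w])"
  note rank = rank_wedge_decomp_less[OF independent_Basis span_Basis finite_Basis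
      split_distinct split_basis k r]
  have "?\<omega>0 \<in> ext_pow scale k" "decomp scale (a @ [u, w]) \<in> ext_pow scale k"
    by (rule decomp_in_ext_pow, simp add: k)+
  moreover from this have "?\<omega>1 \<in> ext_pow scale k"
    unfolding ext_pow_def by (rule fun_vs.span_add)
  ultimately have \<omega>0: "?\<omega>0 \<in> ext_pow scale k - {0}" and \<omega>1: "?\<omega>1 \<in> ext_pow scale k - {0}"
    using rank(2,3) by blast+
  have theta: "theta scale k r \<omega> = wedge scale k r \<omega>" for \<omega>
    by (intro ext) (simp only: theta_def)
  have "rank_on fscale (ext_pow scale r) (theta scale k r ?\<omega>0)
      = rank_on fscale (ext_pow scale r) (theta scale k r ?\<omega>1)"
    by (rule bspec[OF bspec[OF const[unfolded constant_rank_def] \<omega>0] \<omega>1])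
  with rank(1) show False
    unfolding theta by (simp only: less_irrefl)
qed

end
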